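(* Let $P$ be a pregroupoid with unique canonical local units, and let $P[\mathsf{m}]$ be the set $P$ equipped with the restricted partial binary operation $\mathsf{m}:(x,y)\mapsto x\cdot y$, where $x\cdot y$ is defined if and only if $x^{-1}x=yy^{-1}$ for some preinverse $x^{-1}$ of $x$ and some preinverse $y^{-1}$ of $y$, in which case $x\cdot y=xy$. Then $P[\mathsf{m}]$ is a groupoid.
   Context: A magmoid is a non-empty set $P$ with a non-empty partial binary operation $(x,y)\mapsto xy$. A compound product such as $(xy)z$ is defined iff $xy$ is defined and the product of $xy$ with $z$ is defined (similarly for $x(yz)$). An asserted equation between products includes the assertion that both sides are defined. A semigroupoid is a magmoid $P$ such that for all $x,y,z\in P$: if $x(yz)$ is defined, or if $(xy)z$ is defined, or if both $xy$ and $yz$ are defined, then $x(yz)=(xy)z$ (both sides defined). A preinverse of $x\in P$ is some $x^{-1}\in P$ such that $(xx^{-1})x=x(x^{-1}x)=x$ and $(x^{-1}x)x^{-1}=x^{-1}(xx^{-1})=x^{-1}$ (all products defined). A prepoloid is a semigroupoid in which for every $x$ there are elements $\lambda_x,\rho_x$ with $\lambda_x x=x=x\rho_x$ (products defined). A pregroupoid is a prepoloid in which every element has a preinverse. The canonical local left and right units of $x$ are the elements $xx^{-1}$ and $x^{-1}x$, where $x^{-1}$ is a preinverse of $x$; a pregroupoid has unique canonical local units if for every $x$ and all preinverses $x',x''$ of $x$ one has $xx'=xx''$ and $x'x=x''x$. (If $x^{-1}x=yy^{-1}$ then $xy$ is defined, so the restricted operation is well defined.) A two-sided unit in a magmoid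 $Q$ is some $e\in Q$ such that for every $y\in Q$: if $ey$ is defined then $ey=y$, and if $ye$ is defined then $ye=y$. A poloid is a semigroupoid $Q$ in which for every $x\in Q$ there are two-sided units $\ell_x,r_x$ with $\ell_x x=x=xr_x$ (products defined). A strong preinverse of $x$ is a preinverse $x^{-1}$ of $x$ such that $xx^{-1}$ and $x^{-1}x$ are two-sided units. A groupoid is a poloid in which every element has a strong preinverse. *)

theory Defs
  imports Main
begin

text \<open>
  A partial binary operation on a set \<open>P\<close> is a function \<open>m :: 'a \<Rightarrow> 'a \<Rightarrow> 'a option\<close>, where
  \<open>m x y = None\<close> means that \<open>xy\<close> is undefined; only its values on \<open>P\<close> are relevant.
\<close>

locale magmoid =
  fixes P :: "'a set" and m :: "'a \<Rightarrow> 'a \<Rightarrow> 'a option"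
  assumes carrier_nonempty: "P \<noteq> {}"
    and op_nonempty: "\<exists>x\<in>P. \<exists>y\<in>P. m x y \<noteq> None"
    and closed: "\<lbrakk>x \<in> P; y \<in> P; m x y = Some z\<rbrakk> \<Longrightarrow> z \<in> P"

text \<open>The compound products \<open>(xy)z\<close> and \<open>x(yz)\<close>.\<close>

definition lprod :: "('a \<Rightarrow> 'a \<Rightarrow> 'a option) \<Rightarrow> 'a \<Rightarrow> 'a \<Rightarrow> 'a \<Rightarrow> 'a option" where
  "lprod m x y z = Option.bind (m x y) (\<lambda>u. m u z)"

definition rprod :: "('a \<Rightarrow> 'a \<Rightarrow> 'a option) \<Rightarrow> 'a \<Rightarrow> 'a \<Rightarrow> 'a \<Rightarrow> 'a option" where
  "rprod m x y z = Option.bind (m y z) (\<lambda>v. m x v)"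

locale semigroupoid = magmoid P m
  for P :: "'a set" and m :: "'a \<Rightarrow> 'a \<Rightarrow> 'a option" +
  assumes assoc:
    "\<lbrakk>x \<in> P; y \<in> P; z \<in> P;
      rprod m x y z \<noteq> None \<or> lprod m x y z \<noteq> None \<or> (m x y \<noteq> None \<and> m y z \<noteq> None)\<rbrakk>
     \<Longrightarrow> rprod m x y z \<noteq> None \<and> lprod m x y z \<noteq> None \<and> rprod m x y z = lprod m x y z"

definition preinverse :: "'a set \<Rightarrow> ('a \<Rightarrow> 'a \<Rightarrow> 'a option) \<Rightarrow> 'a \<Rightarrow> 'a \<Rightarrow> bool" where
  "preinverse P m x x' \<longleftrightarrow> x \<in> P \<and> x' \<in> P \<and>
     lprod m x x' x = Some x \<and> rprod m x x' x = Some x \<and>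
     lprod m x' x x' = Some x' \<and> rprod m x' x x' = Some x'"

locale prepoloid = semigroupoid P m
  for P :: "'a set" and m :: "'a \<Rightarrow> 'a \<Rightarrow> 'a option" +
  assumes local_units: "x \<in> P \<Longrightarrow> \<exists>l\<in>P. \<exists>r\<in>P. m l x = Some x \<and> m x r = Some x"

locale pregroupoid = prepoloid P m
  for P :: "'a set" and m :: "'a \<Rightarrow> 'a \<Rightarrow> 'a option" +
  assumes ex_preinverse: "x \<in> P \<Longrightarrow> \<exists>x'. preinverse P m x x'"

text \<open>
  For a preinverse \<open>x'\<close> of \<open>x\<close>, both \<open>xx'\<close> and \<open>x'x\<close> are defined, so equality of the option values
  below is equality of actual products.
\<close>

definition unique_canonical_local_units :: "'a set \<Rightarrow> ('a \<Rightarrow> 'a \<Rightarrow> 'a option) \<Rightarrow> bool" where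
  "unique_canonical_local_units P m \<longleftrightarrow>
     (\<forall>x\<in>P. \<forall>x' x''. preinverse P m x x' \<and> preinverse P m x x'' \<longrightarrow>
        m x x' = m x x'' \<and> m x' x = m x'' x)"

definition two_sided_unit :: "'a set \<Rightarrow> ('a \<Rightarrow> 'a \<Rightarrow> 'a option) \<Rightarrow> 'a \<Rightarrow> bool" where
  "two_sided_unit Q m e \<longleftrightarrow> e \<in> Q \<and>
     (\<forall>y\<in>Q. (m e y \<noteq> None \<longrightarrow> m e y = Some y) \<and> (m y e \<noteq> None \<longrightarrow> m y e = Some y))"

locale poloid = semigroupoid Q m
  for Q :: "'a set" and m :: "'a \<Rightarrow> 'a \<Rightarrow> 'a option" +
  assumes units: "x \<in> Q \<Longrightarrow>
    \<exists>l r. two_sided_unit Q m l \<and> two_sided_unit Q m r \<and> m l x = Some x \<and> m x r = Some x"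

definition strong_preinverse :: "'a set \<Rightarrow> ('a \<Rightarrow> 'a \<Rightarrow> 'a option) \<Rightarrow> 'a \<Rightarrow> 'a \<Rightarrow> bool" where
  "strong_preinverse Q m x x' \<longleftrightarrow> preinverse Q m x x' \<and>
     (\<exists>e f. m x x' = Some e \<and> m x' x = Some f \<and> two_sided_unit Q m e \<and> two_sided_unit Q m f)"

locale groupoid = poloid Q m
  for Q :: "'a set" and m :: "'a \<Rightarrow> 'a \<Rightarrow> 'a option" +
  assumes ex_strong_preinverse: "x \<in> Q \<Longrightarrow> \<exists>x'. strong_preinverse Q m x x'"

definition composable :: "'a set \<Rightarrow> ('a \<Rightarrow> 'a \<Rightarrow> 'a option) \<Rightarrow> 'a \<Rightarrow> 'a \<Rightarrow> bool" where
  "composable P m x y \<longleftrightarrow>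
     (\<exists>x' y'. preinverse P m x x' \<and> preinverse P m y y' \<and> m x' x \<noteq> None \<and> m x' x = m y y')"

definition restricted_op :: "'a set \<Rightarrow> ('a \<Rightarrow> 'a \<Rightarrow> 'a option) \<Rightarrow> 'a \<Rightarrow> 'a \<Rightarrow> 'a option" where
  "restricted_op P m x y = (if composable P m x y then m x y else None)"

text \<open>
  The restricted operation is well defined: whenever \<open>x\<close> and \<open>y\<close> are composable, the product \<open>xy\<close>
  exists, so that the domain of the restricted operation is exactly the composability relation.
\<close>

lemma (in semigroupoid) composable_imp_defined:
  assumes "composable P m x y"
  shows "m x y \<noteq> None"
proof -
  obtain x' y' e where p: "preinverse P m x x'" "preinverse P m y y'"
    and e: "m x' x = Some e" "m y y' = Some e"
    using assms unfolding composable_def by (metis option.exhaust)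
  have P: "x \<in> P" "y \<in> P" "x' \<in> P" using p by (auto simp: preinverse_def)
  have xe: "m x e = Some x" using p(1) e(1) by (simp add: preinverse_def rprod_def)
  have ey: "m e y = Some y" using p(2) e(2) by (simp add: preinverse_def lprod_def)
  have "e \<in> P" using closed[OF P(3) P(1) e(1)] .
  from assoc[OF P(1) this P(2)] xe ey show ?thesis by (simp add: rprod_def)
qed

lemma (in semigroupoid) restricted_op_defined_iff:
  "restricted_op P m x y \<noteq> None \<longleftrightarrow> composable P m x y"
  using composable_imp_defined by (auto simp: restricted_op_def)

end

theory Submission
  imports Defs
begin

text \<open>
  Uniqueness makes the left and right canonical units \<open>lunit x\<close> and \<open>runit x\<close> functions of \<open>x\<close>, and
  \<open>x \<cdot> y\<close> is defined iff \<open>runit x = lunit y\<close>. If \<open>x'\<close> and \<open>y'\<close> are preinverses of \<open>x\<close> and \<open>y\<close>, then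
  \<open>y'x'\<close> is a preinverse of \<open>x \<cdot> y\<close>, whence \<open>lunit (x \<cdot> y) = lunit x\<close> and
  \<open>runit (x \<cdot> y) = runit y\<close>. So \<open>P\<close> composes like the arrows of a category whose objects are the
  canonical units, and the preinverses of \<open>P\<close> become inverses.
\<close>

lemma (in semigroupoid) assoc_eq:
  assumes "x \<in> P" "y \<in> P" "z \<in> P" "m x y = Some u" "m y z = Some v"
  shows "m u z = m x v"
  using assoc[OF assms(1-3)] assms(4,5) by (auto simp: lprod_def rprod_def)

lemma preinverse_iff:
  "preinverse P m x x' \<longleftrightarrow> x \<in> P \<and> x' \<in> P \<and>
     (\<exists>e f. m x x' = Some e \<and> m x' x = Some f \<and> m e x = Some x \<and> m x f = Some x \<and>
            m f x' = Some x' \<and> m x' e = Some x')"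
  unfolding preinverse_def lprod_def rprod_def bind_eq_Some_conv by auto

lemma preinverse_sym: "preinverse P m x x' \<Longrightarrow> preinverse P m x' x"
  unfolding preinverse_def by blast

locale unital_pregroupoid = pregroupoid P m
  for P :: "'a set" and m :: "'a \<Rightarrow> 'a \<Rightarrow> 'a option" +
  assumes unique_units: "unique_canonical_local_units P m"
begin

definition pinv :: "'a \<Rightarrow> 'a" where
  "pinv x = (SOME x'. preinverse P m x x')"

definition lunit :: "'a \<Rightarrow> 'a" where
  "lunit x = the (m x (pinv x))"

definition runit :: "'a \<Rightarrow> 'a" where
  "runit x = the (m (pinv x) x)"

abbreviation rop :: "'a \<Rightarrow> 'a \<Rightarrow> 'a option" where
  "rop \<equiv> restricted_op P m"

lemma preinverse_pinv: "x \<in> P \<Longrightarrow> preinverse P m x (pinv x)"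
  unfolding pinv_def by (rule someI_ex) (rule ex_preinverse)

text \<open>The uniqueness hypothesis enters here: it frees \<open>lunit\<close> and
  \<open>runit\<close> from the choice made in \<open>pinv\<close>, so units can be computed from
  whichever preinverse is at hand.\<close>

lemma preinverse_units:
  assumes "preinverse P m x x'"
  shows "m x x' = Some (lunit x)" "m x' x = Some (runit x)"
proof -
  have x: "x \<in> P" using assms by (simp add: preinverse_def)
  have p: "preinverse P m x (pinv x)" using x by (rule preinverse_pinv)
  have "m x x' = m x (pinv x)" "m x' x = m (pinv x) x"
    using unique_units x p assms unfolding unique_canonical_local_units_def by blast+
  moreover have "m x (pinv x) \<noteq> None" "m (pinv x) x \<noteq> None"
    using p by (auto simp: preinverse_iff)
  ultimately show "m x x' = Some (lunit x)" "m x' x = Some (runit x)"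
    by (simp_all add: lunit_def runit_def)
qed

lemma unit_laws:
  assumes "x \<in> P"
  shows "lunit x \<in> P" "runit x \<in> P" "m (lunit x) x = Some x" "m x (runit x) = Some x"
proof -
  note p = preinverse_pinv[OF assms]
  note u = preinverse_units[OF p]
  show "m (lunit x) x = Some x" "m x (runit x) = Some x"
    using p u by (auto simp: preinverse_iff)
  have "pinv x \<in> P" using p by (simp add: preinverse_def)
  then show "lunit x \<in> P" "runit x \<in> P" using closed assms u by blast+
qed

text \<open>Being a preinverse is a symmetric relation, so the same two products serve
  \<open>x\<close> and \<open>x'\<close>, with left and right interchanged.\<close>

lemma units_preinverse:
  assumes "preinverse P m x x'"
  shows "lunit x' = runit x" "runit x' = lunit x"
  using preinverse_units[OF assms] preinverse_units[OF preinverse_sym[OF assms]] by simp_all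

lemma composable_iff: "composable P m x y \<longleftrightarrow> x \<in> P \<and> y \<in> P \<and> runit x = lunit y"
proof
  assume "composable P m x y"
  then obtain x' y' where "preinverse P m x x'" "preinverse P m y y'" "m x' x = m y y'"
    unfolding composable_def by blast
  then show "x \<in> P \<and> y \<in> P \<and> runit x = lunit y"
    using preinverse_units by (auto simp: preinverse_def)
next
  assume a: "x \<in> P \<and> y \<in> P \<and> runit x = lunit y"
  then have p: "preinverse P m x (pinv x)" "preinverse P m y (pinv y)"
    by (simp_all add: preinverse_pinv)
  then show "composable P m x y"
    unfolding composable_def using a preinverse_units[OF p(1)] preinverse_units[OF p(2)] by force
qed

lemma rop_defined_iff: "rop x y \<noteq> None \<longleftrightarrow> x \<in> P \<and> y \<in> P \<and> runit x = lunit y"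
  by (simp only: restricted_op_defined_iff composable_iff)

lemma rop_eq: "x \<in> P \<Longrightarrow> y \<in> P \<Longrightarrow> runit x = lunit y \<Longrightarrow> rop x y = m x y"
  by (simp add: restricted_op_def composable_iff)

lemma units_prod:
  assumes "rop x y = Some z"
  shows "z \<in> P" "lunit z = lunit x" "runit z = runit y"
proof -
  have P: "x \<in> P" "y \<in> P" and e: "runit x = lunit y" using rop_defined_iff[of x y] assms by auto
  have z: "m x y = Some z" using assms rop_eq P e by simp
  show zP: "z \<in> P" using closed P z by blast
  obtain x' where p: "preinverse P m x x'" using P ex_preinverse by blast
  obtain y' where q: "preinverse P m y y'" using P ex_preinverse by blast
  have P': "x' \<in> P" "y' \<in> P" using p q by (auto simp: preinverse_def)
  note units = unit_laws[OF P(1)] unit_laws[OF P(2)] unit_laws[OF P'(1)] unit_laws[OF P'(2)]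
  note prods = preinverse_units[OF p] preinverse_units[OF q]
  \<comment> \<open>Here \<open>runit y' = lunit y = runit x = lunit x'\<close>, so the candidate
    \<open>w = y'x'\<close> is defined.\<close>
  have "runit y' = lunit x'"
    using units_preinverse[OF p] units_preinverse[OF q] e by simp
  then obtain w where w: "m y' x' = Some w"
    using composable_imp_defined[of y' x'] composable_iff P' by auto
  have wP: "w \<in> P" using closed P' w by blast
  \<comment> \<open>Inner pairs cancel: \<open>(xy)y' = x(yy') = x(x'x) = x\<close>, hence
    \<open>(xy)(y'x') = xx'\<close>; the mirror computation then gives
    \<open>(y'x')(xy) = y'y\<close>.\<close>
  have "m z y' = Some x"
    using assoc_eq[OF P(1,2) P'(2) z prods(3)] units(4) e by simp
  then have zw: "m z w = Some (lunit x)"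
    using assoc_eq[OF zP P'(2,1) _ w] prods(1) by simp
  have "m x' z = Some y"
    using assoc_eq[OF P'(1) P prods(2) z] units(7) e by simp
  then have wz: "m w z = Some (runit y)"
    using assoc_eq[OF P'(2,1) zP w] prods(4) by simp
  \<comment> \<open>The other four preinverse laws follow by moving the unit onto the adjacent
    factor of \<open>z\<close> or \<open>w\<close>, which it fixes.\<close>
  have "m (lunit x) z = Some z"
    using assoc_eq[OF units(1) P units(3) z] z by simp
  moreover have "m z (runit y) = Some z"
    using assoc_eq[OF P units(6) z units(8)] z by simp
  moreover have "m w (lunit x) = Some w"
    using assoc_eq[OF P'(2,1) units(1) w] units(12) w units_preinverse[OF p] by simp
  moreover have "m (runit y) w = Some w"
    using assoc_eq[OF units(6) P'(2,1) _ w] units(15) w units_preinverse[OF q] by simp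
  ultimately have "preinverse P m z w"
    unfolding preinverse_iff using zP wP zw wz by simp
  then show "lunit z = lunit x" "runit z = runit y" using preinverse_units zw wz by fastforce+
qed

text \<open>Each unit is itself a restricted product of \<open>x\<close> and a preinverse, so
  \<open>units_prod\<close> computes its units.\<close>

lemma units_of_units:
  assumes "x \<in> P"
  shows "lunit (lunit x) = lunit x" "runit (lunit x) = lunit x"
    "lunit (runit x) = runit x" "runit (runit x) = runit x"
proof -
  note p = preinverse_pinv[OF assms]
  have P: "pinv x \<in> P" using p by (simp add: preinverse_def)
  have r: "rop x (pinv x) = Some (lunit x)" "rop (pinv x) x = Some (runit x)"
    using rop_eq assms P units_preinverse[OF p] preinverse_units[OF p] by simp_all
  show "lunit (lunit x) = lunit x" "runit (lunit x) = lunit x"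
    "lunit (runit x) = runit x" "runit (runit x) = runit x"
    using units_prod[OF r(1)] units_prod[OF r(2)] units_preinverse[OF p] by simp_all
qed

lemma rop_units:
  assumes "x \<in> P"
  shows "rop (lunit x) x = Some x" "rop x (runit x) = Some x"
  using rop_eq assms unit_laws units_of_units by simp_all

text \<open>If \<open>rop e y\<close> is defined then \<open>lunit y = runit e = e\<close>, so
  \<open>e\<close> acts as the left unit of \<open>y\<close> itself; dually on the right.\<close>

lemma two_sided_unit_rop:
  assumes P: "e \<in> P" and e: "lunit e = e" "runit e = e"
  shows "two_sided_unit P rop e"
  unfolding two_sided_unit_def
proof (intro conjI ballI impI P)
  fix y assume y: "y \<in> P"
  show "rop e y = Some y" if "rop e y \<noteq> None"
    using that rop_defined_iff[of e y] rop_units(1)[OF y] e by auto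
  show "rop y e = Some y" if "rop y e \<noteq> None"
    using that rop_defined_iff[of y e] rop_units(2)[OF y] e by auto
qed

lemma two_sided_unit_lunit: "x \<in> P \<Longrightarrow> two_sided_unit P rop (lunit x)"
  and two_sided_unit_runit: "x \<in> P \<Longrightarrow> two_sided_unit P rop (runit x)"
  by (simp_all add: two_sided_unit_rop unit_laws units_of_units)

text \<open>A product \<open>v = yz\<close> inherits the left unit of \<open>y\<close>, so
  \<open>x\<close> composes with \<open>v\<close> exactly when it composes with \<open>y\<close>.
  Together with its mirror image this makes the three alternatives in the semigroupoid axiom
  equivalent.\<close>

lemma rprod_rop_defined:
  "rprod rop x y z \<noteq> None \<longleftrightarrow> rop x y \<noteq> None \<and> rop y z \<noteq> None"
proof (cases "rop y z")
  case (Some v)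
  then have "rop y z \<noteq> None" by simp
  then have "y \<in> P" by (simp only: rop_defined_iff)
  then show ?thesis
    using rop_defined_iff[of x v] rop_defined_iff[of x y] units_prod[OF Some] Some
    by (simp add: rprod_def)
qed (simp add: rprod_def)

lemma lprod_rop_defined:
  "lprod rop x y z \<noteq> None \<longleftrightarrow> rop x y \<noteq> None \<and> rop y z \<noteq> None"
proof (cases "rop x y")
  case (Some u)
  then have "rop x y \<noteq> None" by simp
  then have "y \<in> P" by (simp only: rop_defined_iff)
  then show ?thesis
    using rop_defined_iff[of u z] rop_defined_iff[of y z] units_prod[OF Some] Some
    by (simp add: lprod_def)
qed (simp add: lprod_def)

lemma rop_assoc:
  assumes "rop x y = Some u" "rop y z = Some v"
  shows "rop u z = rop x v"
proof -
  have P: "x \<in> P" "y \<in> P" "z \<in> P" and e: "runit x = lunit y" "runit y = lunit z"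
    using rop_defined_iff[of x y] rop_defined_iff[of y z] assms by auto
  have "m u z = m x v"
    using assoc_eq[OF P] assms rop_eq P e by simp
  \<comment> \<open>By \<open>units_prod\<close>, \<open>runit u = lunit z\<close> and
    \<open>runit x = lunit v\<close>, so both outer products lie in the domain of \<open>rop\<close>
    and agree there with \<open>m\<close>.\<close>
  then show ?thesis
    using rop_eq P e units_prod[OF assms(1)] units_prod[OF assms(2)] by simp
qed

text \<open>Restriction loses no product occurring in the preinverse laws, because all factors there
  meet along equal units.\<close>

lemma preinverse_rop:
  assumes "preinverse P m x x'"
  shows "preinverse P rop x x'"
proof -
  have P: "x \<in> P" "x' \<in> P" using assms by (auto simp: preinverse_def)
  have "rop x x' = Some (lunit x)" "rop x' x = Some (runit x)"
    using rop_eq P units_preinverse[OF assms] preinverse_units[OF assms] by simp_all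
  then show ?thesis
    unfolding preinverse_iff
    using P rop_units[OF P(1)] rop_units[OF P(2)] units_preinverse[OF assms] by simp
qed

lemma semigroupoid_rop: "semigroupoid P rop"
proof unfold_locales
  show "P \<noteq> {}" by (rule carrier_nonempty)
  then obtain x where x: "x \<in> P" by blast
  \<comment> \<open>The product of \<open>x\<close> with its right unit survives the
    restriction.\<close>
  show "\<exists>x\<in>P. \<exists>y\<in>P. rop x y \<noteq> None"
    using x unit_laws(2)[OF x] rop_units(2)[OF x] by force
  show "z \<in> P" if "rop x y = Some z" for x y z
    using that by (rule units_prod)
  fix x y z
  assume "rprod rop x y z \<noteq> None \<or> lprod rop x y z \<noteq> None \<or> (rop x y \<noteq> None \<and> rop y z \<noteq> None)"
  then have d: "rop x y \<noteq> None \<and> rop y z \<noteq> None"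
    by (simp only: rprod_rop_defined lprod_rop_defined) blast
  then obtain u v where uv: "rop x y = Some u" "rop y z = Some v" by auto
  then have "rprod rop x y z = lprod rop x y z"
    using rop_assoc[OF uv] by (simp add: rprod_def lprod_def)
  then show "rprod rop x y z \<noteq> None \<and> lprod rop x y z \<noteq> None \<and>
      rprod rop x y z = lprod rop x y z"
    using d rprod_rop_defined lprod_rop_defined by blast
qed

lemma groupoid_rop: "groupoid P rop"
proof -
  interpret R: semigroupoid P rop by (rule semigroupoid_rop)
  show ?thesis
  proof unfold_locales
    fix x assume x: "x \<in> P"
    show "\<exists>l r. two_sided_unit P rop l \<and> two_sided_unit P rop r \<and>
        rop l x = Some x \<and> rop x r = Some x"
      using two_sided_unit_lunit two_sided_unit_runit rop_units x by blast
    note p = preinverse_pinv[OF x]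
    have "pinv x \<in> P" using p by (simp add: preinverse_def)
    then have "rop x (pinv x) = Some (lunit x)" "rop (pinv x) x = Some (runit x)"
      using rop_eq x units_preinverse[OF p] preinverse_units[OF p] by simp_all
    \<comment> \<open>The two products are the canonical units of \<open>x\<close>, which are
      two-sided units for the restricted operation.\<close>
    then show "\<exists>x'. strong_preinverse P rop x x'"
      unfolding strong_preinverse_def
      using preinverse_rop[OF p] two_sided_unit_lunit[OF x] two_sided_unit_runit[OF x] by blast
  qed
qed

end

theorem theorem8p2:
  fixes P :: "'a set" and m :: "'a \<Rightarrow> 'a \<Rightarrow> 'a option"
  assumes "pregroupoid P m"
    and "unique_canonical_local_units P m"
  shows "groupoid P (restricted_op P m)"
  using assms
  by (intro unital_pregroupoid.groupoid_rop unital_pregroupoid.intro unital_pregroupoid_axioms.intro)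

end
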